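(* Assume there are two buyers, $1$ and $2$, and two goods, $A$ and $B$, such that each buyer gains no marginal benefit from having both goods. Let the signal spaces $\mathcal S_{i,A},\mathcal S_{i,B}$ ($i=1,2$) be open intervals of the real numbers, with $s_{iA}\in\mathcal S_{i,A}$ and $s_{iB}\in\mathcal S_{i,B}$, and let the valuation functions be positive and satisfy, for linear functions $w_1,w_2,f_1,f_2,g_1,g_2:\mathbb R\to\mathbb R$ with $w_1,w_2$ strictly increasing, $$v_{1A}(s_{1A},s_{2A})=w_1(s_{1A})+g_1(s_{2A}),\qquad v_{1B}(s_{1B},s_{2B})=w_1(s_{1B})+g_2(s_{2B}),$$ $$v_{2A}(s_{1A},s_{2A})=w_2(s_{2A})+f_1(s_{1A}),\qquad v_{2B}(s_{1B},s_{2B})=w_2(s_{2B})+f_2(s_{1B}).$$ If there is an efficient auction mechanism, then $f_1'(\cdot)=f_2'(\cdot)$.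
   Context: "Linear" means of the form $x\mapsto ax+b$. Buyer $i$ privately observes the pair $t_i=(s_{iA},s_{iB})$. "No marginal benefit from having both goods" means that buyer $i$'s valuation of $\{A,B\}$ is $\max(v_{iA},v_{iB})$; the valuation of the empty set is $0$. An allocation partitions the goods among the buyers, and its welfare is the sum of the buyers' valuations of the sets they receive. An auction mechanism gives each buyer a set of possible actions; a (pure) strategy $\sigma_i$ assigns an action to each $t_i$. Depending only on the profile of actions, the mechanism determines a (possibly random) allocation and an expected payment for each buyer. A buyer's utility is the expected valuation (at the true signals) of the goods received minus the expected payment. A strategy profile is a Nash equilibrium if, for every profile of signals and every buyer $i$, no other strategy of buyer $i$ gives buyer $i$ a strictly higher utility when the other buyer keeps his or her strategy. The mechanism is efficient if it has a Nash equilibrium under which, for every profile of signals, the resulting allocation is always welfare-maximizing.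
   Formalization: Added assumption: no single allocation is welfare-maximizing at every profile of signals (intervals nonempty). Without it the claim fails: a constant allocation with zero payments is then efficient for any slopes of f_1, f_2, e.g. S_{1A}=(100,101), other intervals (1,2), w_i=f_2=id, f_1=g_i=0. *)

theory Defs
  imports "HOL-Probability.Probability_Mass_Function" "HOL-Analysis.Analysis"
begin

datatype buyer = Buyer1 | Buyer2

datatype good = GoodA | GoodB

lemma UNIV_buyer: "(UNIV :: buyer set) = {Buyer1, Buyer2}"
  by (auto intro: buyer.exhaust)

lemma UNIV_good: "(UNIV :: good set) = {GoodA, GoodB}"
  by (auto intro: good.exhaust)

instance buyer :: finite
  by standard (simp add: UNIV_buyer)

instance good :: finite
  by standard (simp add: UNIV_good)

definition linear_fun :: "(real \<Rightarrow> real) \<Rightarrow> bool" where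
  "linear_fun f \<longleftrightarrow> (\<exists>a b. \<forall>x. f x = a * x + b)"

definition open_interval :: "real set \<Rightarrow> bool" where
  "open_interval I \<longleftrightarrow> open I \<and> is_interval I \<and> I \<noteq> {}"

text \<open>A buyer's private information is the signal for each good.\<close>

type_synonym signals = "good \<Rightarrow> real"

text \<open>\<open>v i g x y\<close> is buyer \<open>i\<close>'s value of good \<open>g\<close> when the signals of
  \<open>Buyer1\<close> and \<open>Buyer2\<close> about \<open>g\<close> are \<open>x\<close> and \<open>y\<close>, in this order for both buyers.\<close>

type_synonym valuations = "buyer \<Rightarrow> good \<Rightarrow> real \<Rightarrow> real \<Rightarrow> real"

text \<open>A partition of the goods among the buyers, given by the recipient of each good.\<close>

type_synonym allocation = "good \<Rightarrow> buyer"

definition own_signals :: "(buyer \<Rightarrow> good \<Rightarrow> real set) \<Rightarrow> buyer \<Rightarrow> signals set" where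
  "own_signals S i = {s. \<forall>g. s g \<in> S i g}"

definition signal_profiles :: "(buyer \<Rightarrow> good \<Rightarrow> real set) \<Rightarrow> (buyer \<Rightarrow> signals) set" where
  "signal_profiles S = {t. \<forall>i. t i \<in> own_signals S i}"

definition good_value :: "valuations \<Rightarrow> (buyer \<Rightarrow> signals) \<Rightarrow> buyer \<Rightarrow> good \<Rightarrow> real" where
  "good_value v t i g = v i g (t Buyer1 g) (t Buyer2 g)"

definition set_value :: "valuations \<Rightarrow> (buyer \<Rightarrow> signals) \<Rightarrow> buyer \<Rightarrow> good set \<Rightarrow> real" where
  "set_value v t i G = (if G = {} then 0 else Max (good_value v t i ` G))"

definition received :: "allocation \<Rightarrow> buyer \<Rightarrow> good set" where
  "received X i = {g. X g = i}"

definition welfare :: "valuations \<Rightarrow> (buyer \<Rightarrow> signals) \<Rightarrow> allocation \<Rightarrow> real" where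
  "welfare v t X = (\<Sum>i\<in>UNIV. set_value v t i (received X i))"

definition welfare_maximizing :: "valuations \<Rightarrow> (buyer \<Rightarrow> signals) \<Rightarrow> allocation \<Rightarrow> bool" where
  "welfare_maximizing v t X \<longleftrightarrow> (\<forall>Y. welfare v t Y \<le> welfare v t X)"

text \<open>Both buyers' actions live in one type \<open>'a\<close>; this is no restriction, since the action sets
  may be arbitrary (for instance the two halves of a sum type).\<close>

record 'a mechanism =
  actions :: "buyer \<Rightarrow> 'a set"
  outcome :: "(buyer \<Rightarrow> 'a) \<Rightarrow> allocation pmf"
  payment :: "(buyer \<Rightarrow> 'a) \<Rightarrow> buyer \<Rightarrow> real"

definition strategies ::
  "(buyer \<Rightarrow> good \<Rightarrow> real set) \<Rightarrow> 'a mechanism \<Rightarrow> buyer \<Rightarrow> (signals \<Rightarrow> 'a) set" where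
  "strategies S M i = {\<tau>. \<forall>s\<in>own_signals S i. \<tau> s \<in> actions M i}"

definition played :: "(buyer \<Rightarrow> signals \<Rightarrow> 'a) \<Rightarrow> (buyer \<Rightarrow> signals) \<Rightarrow> buyer \<Rightarrow> 'a" where
  "played \<sigma> t = (\<lambda>i. \<sigma> i (t i))"

definition utility ::
  "valuations \<Rightarrow> 'a mechanism \<Rightarrow> (buyer \<Rightarrow> signals \<Rightarrow> 'a) \<Rightarrow> (buyer \<Rightarrow> signals) \<Rightarrow> buyer \<Rightarrow> real" where
  "utility v M \<sigma> t i =
     measure_pmf.expectation (outcome M (played \<sigma> t)) (\<lambda>X. set_value v t i (received X i))
       - payment M (played \<sigma> t) i"

definition nash_equilibrium ::
  "(buyer \<Rightarrow> good \<Rightarrow> real set) \<Rightarrow> valuations \<Rightarrow> 'a mechanism \<Rightarrow> (buyer \<Rightarrow> signals \<Rightarrow> 'a) \<Rightarrow> bool" where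
  "nash_equilibrium S v M \<sigma> \<longleftrightarrow>
     (\<forall>i. \<sigma> i \<in> strategies S M i) \<and>
     (\<forall>t\<in>signal_profiles S. \<forall>i. \<forall>\<tau>\<in>strategies S M i.
        utility v M (\<sigma>(i := \<tau>)) t i \<le> utility v M \<sigma> t i)"

definition efficient_mechanism ::
  "(buyer \<Rightarrow> good \<Rightarrow> real set) \<Rightarrow> valuations \<Rightarrow> 'a mechanism \<Rightarrow> bool" where
  "efficient_mechanism S v M \<longleftrightarrow>
     (\<exists>\<sigma>. nash_equilibrium S v M \<sigma> \<and>
        (\<forall>t\<in>signal_profiles S. \<forall>X\<in>set_pmf (outcome M (played \<sigma> t)). welfare_maximizing v t X))"

text \<open>Degenerate case: one allocation is welfare-maximizing at every signal profile. The mechanism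
  that always chooses it, without payments, is then efficient whatever the slopes of the valuations
  are, so a necessary condition on these slopes must exclude this case.\<close>

definition constant_efficient_allocation ::
  "(buyer \<Rightarrow> good \<Rightarrow> real set) \<Rightarrow> valuations \<Rightarrow> bool" where
  "constant_efficient_allocation S v \<longleftrightarrow>
     (\<exists>X. \<forall>t\<in>signal_profiles S. welfare_maximizing v t X)"

end

theory Submission
  imports Defs
begin

text \<open>Since values are positive, an efficient allocation gives one good to each buyer. With \<open>gain t\<close>
  the welfare advantage of giving \<open>A\<close> to \<open>Buyer1\<close> and \<open>B\<close> to \<open>Buyer2\<close> over the opposite split,
  an affine function of the signals, the two incentive constraints between two types of \<open>Buyer1\<close>
  on opposite sides of the hyperplane \<open>gain = 0\<close> show that \<open>w1 s\<^sub>1\<^sub>A - w1 s\<^sub>1\<^sub>B\<close> is larger on the positive side.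
  By nondegeneracy the hyperplane meets the signal space, so it can be crossed there in any direction
  of \<open>Buyer1\<close>'s signals, and hence the gradient of \<open>gain\<close> in \<open>(s\<^sub>1\<^sub>A, s\<^sub>1\<^sub>B)\<close> is a multiple of \<open>(1, -1)\<close>.\<close>

definition assign :: "buyer \<Rightarrow> buyer \<Rightarrow> allocation" where
  "assign i j = (\<lambda>g. case g of GoodA \<Rightarrow> i | GoodB \<Rightarrow> j)"

lemma assign_eta: "X = assign (X GoodA) (X GoodB)"
  by (auto simp: assign_def split: good.split)

lemma received_assign:
  "received (assign i j) k = (if i = k then {GoodA} else {}) \<union> (if j = k then {GoodB} else {})"
proof -
  have "(g \<in> received (assign i j) k) = (g \<in> (if i = k then {GoodA} else {}) \<union> (if j = k then {GoodB} else {}))" for g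
    by (cases g) (auto simp: received_def assign_def)
  then show ?thesis by blast
qed

lemma welfare_assign:
  "welfare v t (assign Buyer1 Buyer2) = good_value v t Buyer1 GoodA + good_value v t Buyer2 GoodB"
  "welfare v t (assign Buyer2 Buyer1) = good_value v t Buyer1 GoodB + good_value v t Buyer2 GoodA"
  "welfare v t (assign i i) = max (good_value v t i GoodA) (good_value v t i GoodB)"
  by (cases i; simp add: welfare_def set_value_def UNIV_buyer received_assign max.commute)+

definition gain :: "valuations \<Rightarrow> (buyer \<Rightarrow> signals) \<Rightarrow> real" where
  "gain v t = welfare v t (assign Buyer1 Buyer2) - welfare v t (assign Buyer2 Buyer1)"

text \<open>If one buyer holds both goods, only the better of the two counts. Handing the other good
  to the opponent then adds a positive value, so some split is strictly better.\<close>

lemma welfare_maximizing_iff: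
  assumes pos: "\<And>i g. good_value v t i g > 0"
  shows "welfare_maximizing v t X \<longleftrightarrow>
    X = assign Buyer1 Buyer2 \<and> gain v t \<ge> 0 \<or> X = assign Buyer2 Buyer1 \<and> gain v t \<le> 0"
    (is "_ \<longleftrightarrow> ?R")
proof -
  have le: "welfare v t Y \<le> max (welfare v t (assign Buyer1 Buyer2)) (welfare v t (assign Buyer2 Buyer1))"
    and less: "Y GoodA = Y GoodB \<Longrightarrow>
      welfare v t Y < max (welfare v t (assign Buyer1 Buyer2)) (welfare v t (assign Buyer2 Buyer1))" for Y
    using pos[of Buyer1 GoodA] pos[of Buyer1 GoodB] pos[of Buyer2 GoodA] pos[of Buyer2 GoodB]
    by (subst assign_eta[of Y], cases "Y GoodA"; cases "Y GoodB"; simp add: welfare_assign; linarith)+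
  show ?thesis
  proof
    assume max: "welfare_maximizing v t X"
    then have "X GoodA \<noteq> X GoodB"
      using less[of X] unfolding welfare_maximizing_def by (meson leD less_max_iff_disj)
    then have "X = assign Buyer1 Buyer2 \<or> X = assign Buyer2 Buyer1"
      using assign_eta[of X] by (cases "X GoodA"; cases "X GoodB") auto
    then show ?R
      using max unfolding welfare_maximizing_def gain_def by force
  next
    assume ?R
    then show "welfare_maximizing v t X"
      unfolding welfare_maximizing_def gain_def using le by (auto simp: max_def)
  qed
qed

lemma played_deviation: "played (\<sigma>(i := \<lambda>_. \<sigma> i s)) t = played \<sigma> (t(i := s))"
  by (auto simp: played_def)

text \<open>At \<open>t\<close>, buyer \<open>i\<close> can imitate the type \<open>s\<close> by the
  constant strategy \<open>\<lambda>_. \<sigma> i s\<close>. This produces the outcome and payment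
  of \<open>t'\<close>, but the goods are still valued at the true signals \<open>t\<close>.\<close>

lemma incentive_compatible:
  assumes nash: "nash_equilibrium S v M \<sigma>"
    and t: "t \<in> signal_profiles S" and t': "t' \<in> signal_profiles S" and diff: "t' = t(i := s)"
    and out: "outcome M (played \<sigma> t) = return_pmf X"
    and out': "outcome M (played \<sigma> t') = return_pmf Y"
  shows "set_value v t i (received Y i) - payment M (played \<sigma> t') i
    \<le> set_value v t i (received X i) - payment M (played \<sigma> t) i"
proof -
  have "s \<in> own_signals S i"
    using t' by (auto simp: diff signal_profiles_def dest: spec[of _ i])
  then have "(\<lambda>_. \<sigma> i s) \<in> strategies S M i"
    using nash unfolding nash_equilibrium_def strategies_def by blast
  then have "utility v M (\<sigma>(i := \<lambda>_. \<sigma> i s)) t i \<le> utility v M \<sigma> t i"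
    using nash t unfolding nash_equilibrium_def by blast
  then show ?thesis
    using out' by (simp add: utility_def played_deviation out diff)
qed

text \<open>Strict signs of \<open>gain\<close> leave a single efficient allocation, so the possibly
  random outcome is deterministic at both profiles. Adding the constraints against imitating
  \<open>t'\<close> at \<open>t\<close> and \<open>t\<close> at \<open>t'\<close> cancels the
  payments.\<close>

lemma monotone_in_own_signals:
  assumes nash: "nash_equilibrium S v M \<sigma>"
    and eff: "\<And>t X. t \<in> signal_profiles S \<Longrightarrow> X \<in> set_pmf (outcome M (played \<sigma> t)) \<Longrightarrow>
      welfare_maximizing v t X"
    and pos: "\<And>t i g. t \<in> signal_profiles S \<Longrightarrow> good_value v t i g > 0"
    and t: "t \<in> signal_profiles S" and t': "t' \<in> signal_profiles S"
    and diff: "t' = t(Buyer1 := s')"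
    and gain: "gain v t > 0" "gain v t' < 0"
  shows "good_value v t' Buyer1 GoodA - good_value v t' Buyer1 GoodB
    \<le> good_value v t Buyer1 GoodA - good_value v t Buyer1 GoodB"
proof -
  have "set_pmf (outcome M (played \<sigma> t)) \<subseteq> {assign Buyer1 Buyer2}"
    using eff[OF t] welfare_maximizing_iff[OF pos[OF t]] gain by fastforce
  then have out: "outcome M (played \<sigma> t) = return_pmf (assign Buyer1 Buyer2)"
    by (simp add: set_pmf_subset_singleton)
  have "set_pmf (outcome M (played \<sigma> t')) \<subseteq> {assign Buyer2 Buyer1}"
    using eff[OF t'] welfare_maximizing_iff[OF pos[OF t']] gain by fastforce
  then have out': "outcome M (played \<sigma> t') = return_pmf (assign Buyer2 Buyer1)"
    by (simp add: set_pmf_subset_singleton)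
  have revert: "t = t'(Buyer1 := t Buyer1)"
    by (simp add: diff)
  show ?thesis
    using incentive_compatible[OF nash t t' diff out out']
      incentive_compatible[OF nash t' t revert out' out]
    by (simp add: set_value_def received_assign)
qed

lemma open_eventually_translate:
  fixes x p :: real
  assumes "open U" "x \<in> U"
  shows "\<forall>\<^sub>F h in at_right 0. x + h * p \<in> U"
proof -
  have "((\<lambda>h. x + h * p) \<longlongrightarrow> x + 0 * p) (at_right 0)"
    by (intro tendsto_intros)
  then show ?thesis
    using assms by (auto dest: topological_tendstoD)
qed

lemma deriv_affine:
  fixes a b :: real
  assumes "\<And>x. f x = a * x + b"
  shows "deriv f = (\<lambda>_. a)"
proof
  show "deriv f x = a" for x
    unfolding assms[abs_def] by (rule DERIV_imp_deriv) (auto intro!: derivative_eq_intros)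
qed

lemma interval_segment:
  fixes x y \<theta> :: real
  assumes "open_interval I" "x \<in> I" "y \<in> I" "0 \<le> \<theta>" "\<theta> \<le> 1"
  shows "(1 - \<theta>) * x + \<theta> * y \<in> I"
  using convexD[of I x y "1 - \<theta>" \<theta>] assms
  by (simp add: open_interval_def is_interval_convex_1)

theorem lemma4p2:
  fixes S :: "buyer \<Rightarrow> good \<Rightarrow> real set"
    and v :: valuations
    and w1 w2 f1 f2 g1 g2 :: "real \<Rightarrow> real"
    and M :: "'a mechanism"
  assumes intervals: "\<And>i g. open_interval (S i g)"
    and positive: "\<And>i g x y. x \<in> S Buyer1 g \<Longrightarrow> y \<in> S Buyer2 g \<Longrightarrow> v i g x y > 0"
    and linear: "linear_fun w1" "linear_fun w2" "linear_fun f1" "linear_fun f2"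
      "linear_fun g1" "linear_fun g2"
    and increasing: "strict_mono w1" "strict_mono w2"
    and v1A: "\<And>x y. x \<in> S Buyer1 GoodA \<Longrightarrow> y \<in> S Buyer2 GoodA \<Longrightarrow> v Buyer1 GoodA x y = w1 x + g1 y"
    and v1B: "\<And>x y. x \<in> S Buyer1 GoodB \<Longrightarrow> y \<in> S Buyer2 GoodB \<Longrightarrow> v Buyer1 GoodB x y = w1 x + g2 y"
    and v2A: "\<And>x y. x \<in> S Buyer1 GoodA \<Longrightarrow> y \<in> S Buyer2 GoodA \<Longrightarrow> v Buyer2 GoodA x y = w2 y + f1 x"
    and v2B: "\<And>x y. x \<in> S Buyer1 GoodB \<Longrightarrow> y \<in> S Buyer2 GoodB \<Longrightarrow> v Buyer2 GoodB x y = w2 y + f2 x"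
    and nondegenerate: "\<not> constant_efficient_allocation S v"
    and efficient: "efficient_mechanism S v M"
  shows "deriv f1 = deriv f2"
proof (rule ccontr)
  assume neq: "deriv f1 \<noteq> deriv f2"
  obtain W1 W2 F1 F2 G1 G2 c1 c2 d1 d2 e1 e2 where
    w1: "\<And>x. w1 x = W1 * x + c1" and w2: "\<And>x. w2 x = W2 * x + c2" and
    f1: "\<And>x. f1 x = F1 * x + d1" and f2: "\<And>x. f2 x = F2 * x + d2" and
    g1: "\<And>x. g1 x = G1 * x + e1" and g2: "\<And>x. g2 x = G2 * x + e2"
    using linear unfolding linear_fun_def by metis
  have F: "F1 \<noteq> F2"
    using neq deriv_affine[OF f1] deriv_affine[OF f2] by auto
  have W1: "W1 > 0"
    using strict_monoD[OF increasing(1), of 0 1] by (simp add: w1)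
  have mem: "t i g \<in> S i g" if "t \<in> signal_profiles S" for t i g
    using that by (auto simp: signal_profiles_def own_signals_def)
  have pos: "good_value v t i g > 0" if "t \<in> signal_profiles S" for t i g
    using positive mem[OF that] by (simp add: good_value_def)
  define K where "K = e1 + d2 - e2 - d1"
  have gain: "gain v t = (W1 - F1) * t Buyer1 GoodA - (W1 - F2) * t Buyer1 GoodB
      + (G1 - W2) * t Buyer2 GoodA - (G2 - W2) * t Buyer2 GoodB + K"
    if "t \<in> signal_profiles S" for t
    using mem[OF that]
    by (simp add: gain_def welfare_assign good_value_def v1A v1B v2A v2B w1 w2 f1 f2 g1 g2 K_def algebra_simps)
  have "\<exists>t\<in>signal_profiles S. \<not> welfare_maximizing v t X" for X
    using nondegenerate unfolding constant_efficient_allocation_def by blast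
  \<comment> \<open>Each profile comes from the failure of one of the two splits:
    \<open>assign Buyer1 Buyer2\<close> is not optimal at \<open>s\<close>, and
    \<open>assign Buyer2 Buyer1\<close> is not optimal at \<open>t\<close>.\<close>
  then obtain s t where s: "s \<in> signal_profiles S" "gain v s < 0"
    and t: "t \<in> signal_profiles S" "gain v t > 0"
    using welfare_maximizing_iff[OF pos] by (metis linorder_not_le)
  \<comment> \<open>The weight at which the affine function \<open>gain\<close> vanishes on the
    segment from \<open>t\<close> to \<open>s\<close>.\<close>
  define \<theta> where "\<theta> = gain v t / (gain v t - gain v s)"
  have \<theta>: "0 \<le> \<theta>" "\<theta> \<le> 1"
    using s t by (auto simp: \<theta>_def field_simps)
  define r where "r = (\<lambda>i g. (1 - \<theta>) * t i g + \<theta> * s i g)"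
  have r: "r \<in> signal_profiles S"
    using interval_segment[OF intervals mem[OF t(1)] mem[OF s(1)] \<theta>]
    by (simp add: signal_profiles_def own_signals_def r_def)
  have "gain v r = (1 - \<theta>) * gain v t + \<theta> * gain v s"
    unfolding gain[OF r] gain[OF s(1)] gain[OF t(1)] by (simp add: r_def algebra_simps)
  also have "\<dots> = gain v t - \<theta> * (gain v t - gain v s)"
    by (simp add: algebra_simps)
  also have "\<dots> = 0"
    using s t by (simp add: \<theta>_def)
  finally have gain_r: "gain v r = 0" .
  \<comment> \<open>The diagonal direction \<open>(q, q)\<close> leaves \<open>w1 s\<^sub>1\<^sub>A - w1 s\<^sub>1\<^sub>B\<close> fixed but raises the gain by \<open>(F2 - F1)\<^sup>2\<close>;
    a slight tilt makes the former decrease while the gain still increases.\<close>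
  define q where "q = F2 - F1"
  have "((\<lambda>h. q * q - (W1 - F1) * h) \<longlongrightarrow> q * q - (W1 - F1) * 0) (at_right 0)"
    by (intro tendsto_intros)
  moreover have "q * q - (W1 - F1) * 0 > 0"
    using F by (simp add: q_def zero_less_mult_iff) linarith
  ultimately have "\<forall>\<^sub>F h in at_right 0. q * q - (W1 - F1) * h > 0"
    by (rule order_tendstoD(1))
  then have "\<forall>\<^sub>F h in at_right 0. q * q - (W1 - F1) * h > 0 \<and> h > 0"
    by (intro eventually_conj eventually_at_right_less)
  then obtain \<epsilon> where \<epsilon>: "q * q - (W1 - F1) * \<epsilon> > 0" "\<epsilon> > 0"
    using eventually_happens' trivial_limit_at_right_real by blast
  define p where "p = q - \<epsilon>"
  define move where "move = (\<lambda>h. r(Buyer1 := \<lambda>g. r Buyer1 g + h * (case g of GoodA \<Rightarrow> p | GoodB \<Rightarrow> q)))"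
  \<comment> \<open>The Boolean \<open>k\<close> encodes the sign of the step, so one finite
    quantification covers both goods and both \<open>move h\<close> and
    \<open>move (- h)\<close>.\<close>
  have "\<forall>\<^sub>F h in at_right 0. \<forall>g k. r Buyer1 g + h * (if k then u g else - u g) \<in> S Buyer1 g" for u
    using intervals mem[OF r]
    by (intro eventually_all_finite open_eventually_translate) (auto simp: open_interval_def)
  from this[of "\<lambda>g. case g of GoodA \<Rightarrow> p | GoodB \<Rightarrow> q"]
  have "\<forall>\<^sub>F h in at_right 0. move h \<in> signal_profiles S \<and> move (- h) \<in> signal_profiles S"
  proof eventually_elim
    case (elim h)
    from spec[OF spec[OF elim], of _ True] spec[OF spec[OF elim], of _ False] mem[OF r]
    show ?case
      by (simp add: signal_profiles_def own_signals_def move_def)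
  qed
  then have "\<forall>\<^sub>F h in at_right 0. (move h \<in> signal_profiles S \<and> move (- h) \<in> signal_profiles S) \<and> h > 0"
    by (rule eventually_conj[OF _ eventually_at_right_less])
  then obtain h where h: "move h \<in> signal_profiles S" "move (- h) \<in> signal_profiles S" "h > 0"
    using eventually_happens' trivial_limit_at_right_real by blast
  \<comment> \<open>The slope along \<open>(p, q)\<close> is
    \<open>(W1 - F1) * p - (W1 - F2) * q\<close>, which equals the stated factor because
    \<open>p = q - \<epsilon>\<close> and \<open>q = F2 - F1\<close>.\<close>
  have gain_move: "gain v (move k) = k * (q * q - (W1 - F1) * \<epsilon>)" if "move k \<in> signal_profiles S" for k
    using gain_r unfolding gain[OF that] gain[OF r] by (simp add: move_def p_def q_def algebra_simps)
  \<comment> \<open>The signals of \<open>Buyer2\<close> stay fixed, so only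
    \<open>W1 * (p - q) = - W1 * \<epsilon>\<close> per unit of \<open>k\<close> remains.\<close>
  have value_move: "good_value v (move k) Buyer1 GoodA - good_value v (move k) Buyer1 GoodB
      = good_value v r Buyer1 GoodA - good_value v r Buyer1 GoodB - k * (W1 * \<epsilon>)"
    if "move k \<in> signal_profiles S" for k
  proof -
    have "good_value v t Buyer1 GoodA - good_value v t Buyer1 GoodB
        = W1 * (t Buyer1 GoodA - t Buyer1 GoodB) + (c1 + g1 (t Buyer2 GoodA)) - (c1 + g2 (t Buyer2 GoodB))"
      if "t \<in> signal_profiles S" for t
      using mem[OF that] by (simp add: good_value_def v1A v1B w1 algebra_simps)
    from this[OF that] this[OF r] show ?thesis
      by (simp add: move_def p_def algebra_simps)
  qed
  obtain \<sigma> where nash: "nash_equilibrium S v M \<sigma>"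
    and eff: "\<And>t X. t \<in> signal_profiles S \<Longrightarrow> X \<in> set_pmf (outcome M (played \<sigma> t)) \<Longrightarrow>
      welfare_maximizing v t X"
    using efficient unfolding efficient_mechanism_def by blast
  \<comment> \<open>The contradiction: monotonicity wants the value difference at
    \<open>move h\<close> to be at least that at \<open>move (- h)\<close>, yet it is smaller by
    \<open>2 * h * W1 * \<epsilon>\<close>.\<close>
  have "move (- h) = (move h)(Buyer1 := move (- h) Buyer1)"
    by (simp add: move_def)
  moreover have "gain v (move h) > 0" "gain v (move (- h)) < 0"
    using h \<epsilon>(1) by (simp_all add: gain_move)
  ultimately have "good_value v (move (- h)) Buyer1 GoodA - good_value v (move (- h)) Buyer1 GoodB
      \<le> good_value v (move h) Buyer1 GoodA - good_value v (move h) Buyer1 GoodB"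
    using monotone_in_own_signals[OF nash eff pos h(1,2)] by blast
  then have "h * (W1 * \<epsilon>) \<le> 0"
    using value_move[OF h(1)] value_move[OF h(2)] by (simp add: mult_ac)
  moreover have "h * (W1 * \<epsilon>) > 0"
    using h(3) W1 \<epsilon>(2) by simp
  ultimately show False
    by simp
qed

end
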